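(* Let $n\ge2$ be an integer and let $l_\beta$ be the largest lucky number less than or equal to $n$, so $\beta=L(n)$. Then the following two formulas for $l_n$ hold. (1) Define $a_0=n$ and $a_{i+1}=\left\lceil a_i\left(\frac{l_{\beta-i}}{l_{\beta-i}-1}\right)-1\right\rceil$ for $0\le i\le\beta-1$. Then $l_n=a_\beta$; i.e. $$l_n=\left\lceil\left\lceil\cdots\left\lceil\left\lceil n\left(\frac{l_\beta}{l_\beta-1}\right)-1\right\rceil\left(\frac{l_{\beta-1}}{l_{\beta-1}-1}\right)-1\right\rceil\cdots\left(\frac{l_2}{l_2-1}\right)-1\right\rceil\left(\frac{l_1}{l_1-1}\right)-1\right\rceil .$$ (2) Define $b_0=n$ and $b_{i+1}=\left\lfloor \frac{b_i\,l_{\beta-i}-1}{l_{\beta-i}-1}\right\rfloor$ for $0\le i\le\beta-1$. Then $l_n=b_\beta$.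
   Context: Lucky numbers: let $A_0=\mathbb N=\{1,2,3,\dots\}$. Remove every second element of $A_0$ to get $A_1=\{1,3,5,7,\dots\}$. Take the next remaining number, $3$, and remove every third element of $A_1$ (in increasing order) to get $A_2=\{1,3,7,9,13,\dots\}$. Take the next remaining number, $7$, and remove every seventh element of $A_2$ to get $A_3$, and so on. The set of lucky numbers is $A_\infty=\bigcap_i A_i=\{1,3,7,9,13,15,21,25,31,33,\dots\}$. For $n\ge2$, $l_n$ denotes the $n$th lucky number ($l_2=3$, $l_3=7$, $l_4=9,\dots$), and by convention $l_1=2$ (although the first lucky number is $1$). Thus $A_i$ is obtained from $A_{i-1}$ by removing every $l_i$-th element, for all $i\ge1$. For real $x\ge1$, $L(x)$ is the number of lucky numbers (elements of $A_\infty$) less than or equal to $x$. With the convention $l_1=2$, for $n=2$ one has $\beta=1$ and $l_\beta=2$. *)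

theory Defs
  imports Complex_Main "HOL-Library.Infinite_Set"
begin

definition remove_every :: "nat \<Rightarrow> nat set \<Rightarrow> nat set" where
  "remove_every k S = {x \<in> S. \<not> k dvd card {y \<in> S. y \<le> x}}"

text \<open>
  The state after step \<open>i\<close> is the pair of the sieving number last used and the set \<open>A\<^sub>i\<close>.
  Starting from 1, the next remaining number is 2, so the first step
  removes every second element; the subsequent sieving numbers are 3, 7, 9, \<open>\<dots>\<close>.
\<close>

primrec lucky_state :: "nat \<Rightarrow> nat \<times> nat set" where
  "lucky_state 0 = (1, {1..})"
| "lucky_state (Suc i) =
    (let (p, A) = lucky_state i; q = (LEAST q. q \<in> A \<and> p < q)
     in (q, remove_every q A))"

definition lucky_sieve :: "nat \<Rightarrow> nat set" where
  "lucky_sieve i = snd (lucky_state i)"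

definition lucky_numbers :: "nat set" where
  "lucky_numbers = (\<Inter>i. lucky_sieve i)"

text \<open>
  \<open>lucky n\<close> is \<open>l\<^sub>n\<close> for \<open>n \<ge> 1\<close>, with the convention \<open>l\<^sub>1 = 2\<close>; the index is shifted because
  \<^const>\<open>enumerate\<close> counts from 0. The value at \<open>n = 0\<close> is irrelevant.
\<close>

definition lucky :: "nat \<Rightarrow> nat" where
  "lucky n = (if n = 1 then 2 else enumerate lucky_numbers (n - 1))"

definition lucky_count :: "real \<Rightarrow> nat" where
  "lucky_count x = card {m \<in> lucky_numbers. real m \<le> x}"

end

theory Submission imports Defs begin

text \<open>
  Removing every \<open>k\<close>-th element turns the rank \<open>r\<close> of a point into \<open>r - r div k\<close>, and on
  the surviving elements (those with \<open>\<not> k dvd r\<close>) this map is inverted by either of the two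
  rounding formulas. Once the rank of a point is below the next sieving number, no later step removes
  anything up to that point. As \<open>n < l\<^bsub>\<beta>+1\<^esub>\<close>, the number \<open>l\<^sub>n\<close> is therefore the element
  of rank \<open>n\<close> in \<open>A\<^sub>\<beta>\<close>, and undoing the \<open>\<beta>\<close> steps yields its rank in \<open>A\<^sub>0\<close>,
  that is, \<open>l\<^sub>n\<close> itself.
\<close>

section \<open>Ranks and the removal of every \<open>k\<close>-th element\<close>

abbreviation rank :: "nat set \<Rightarrow> nat \<Rightarrow> nat" where
  "rank S x \<equiv> card {y \<in> S. y \<le> x}"

lemma rank_Suc: "rank S (Suc x) = (if Suc x \<in> S then Suc (rank S x) else rank S x)"
proof -
  have "{y \<in> S. y \<le> Suc x} = (if Suc x \<in> S then insert (Suc x) {y \<in> S. y \<le> x} else {y \<in> S. y \<le> x})"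
    by (auto simp: le_Suc_eq)
  then show ?thesis by simp
qed

lemma rank_mono: "x \<le> y \<Longrightarrow> rank S x \<le> rank S y"
  by (rule card_mono) auto

lemma rank_enumerate:
  assumes "infinite S"
  shows "rank S (enumerate S k) = Suc k"
proof -
  have "{y \<in> S. y \<le> enumerate S k} = enumerate S ` {..k}"
  proof (intro equalityI subsetI)
    fix y assume "y \<in> {y \<in> S. y \<le> enumerate S k}"
    then obtain j where "y = enumerate S j" "enumerate S j \<le> enumerate S k"
      using enumerate_Ex[OF assms] by (metis (mono_tags, lifting) mem_Collect_eq)
    then show "y \<in> enumerate S ` {..k}"
      using assms enumerate_mono_le_iff by blast
  qed (use assms in \<open>auto simp: enumerate_in_set enumerate_mono_le_iff\<close>)
  moreover have "inj_on (enumerate S) {..k}"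
    using assms by (meson inj_enumerate inj_on_subset subset_UNIV)
  ultimately show ?thesis by (simp add: card_image)
qed

lemma enumerate_rank:
  assumes "infinite S" "x \<in> S"
  shows "enumerate S (rank S x - 1) = x"
  using assms by (metis enumerate_Ex rank_enumerate diff_Suc_1)

text \<open>Induction on \<open>x\<close>: when an element of \<open>S\<close> raises the rank to
  \<open>r\<close>, the quotient \<open>r div k\<close> increases exactly if \<open>k dvd r\<close>,
  which is exactly when that element is removed.\<close>

lemma rank_remove_every:
  assumes "0 \<notin> S"
  shows "rank (remove_every k S) x = rank S x - rank S x div k"
proof (induction x)
  case 0
  have "{y \<in> S. y \<le> 0} = {}" "{y \<in> remove_every k S. y \<le> 0} = {}"
    using assms by (auto simp: remove_every_def intro!: gr0I)
  then show ?case by (metis card.empty diff_0_eq_0)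
next
  case (Suc x)
  have "Suc x \<in> remove_every k S \<longleftrightarrow> Suc x \<in> S \<and> \<not> k dvd Suc (rank S x)"
    by (auto simp: remove_every_def rank_Suc)
  moreover have "rank S x div k \<le> rank S x" by simp
  ultimately show ?case
    using Suc by (auto simp: rank_Suc div_Suc dvd_eq_mod_eq_0 Suc_diff_le)
qed

lemma infinite_remove_every:
  assumes "infinite S" "0 \<notin> S" "k \<ge> 2"
  shows "infinite (remove_every k S)"
proof
  assume fin: "finite (remove_every k S)"
  define N where "N = card (remove_every k S)"
  \<comment> \<open>\<open>enumerate\<close> counts from 0, so \<open>x\<close> has rank
    \<open>2 * N + 2\<close>. For \<open>k \<ge> 2\<close> at least half of these elements survive,
    that is \<open>N + 1\<close>, one too many.\<close>
  define x where "x = enumerate S (2 * N + 1)"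
  have rk: "rank S x = 2 * N + 2"
    using assms by (simp add: x_def rank_enumerate)
  have "rank (remove_every k S) x \<le> N"
    unfolding N_def using fin by (intro card_mono) auto
  then have "(2 * N + 2) - (2 * N + 2) div k \<le> N"
    unfolding rank_remove_every[OF assms(2)] rk .
  moreover have "(2 * N + 2) div k \<le> (2 * N + 2) div 2"
    using assms by (intro div_le_mono2) auto
  ultimately show False by simp
qed

section \<open>The sieve and its strictly increasing sieving numbers\<close>

definition sieving_number :: "nat \<Rightarrow> nat" where
  "sieving_number i = fst (lucky_state i)"

lemma lucky_sieve_0: "lucky_sieve 0 = {1..}"
  by (simp add: lucky_sieve_def)

lemma sieving_number_0: "sieving_number 0 = 1"
  by (simp add: sieving_number_def)

lemma lucky_sieve_Suc:
  "lucky_sieve (Suc i) = remove_every (sieving_number (Suc i)) (lucky_sieve i)"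
  by (simp add: lucky_sieve_def sieving_number_def Let_def split: prod.split)

lemma sieving_number_Suc:
  "sieving_number (Suc i) = (LEAST q. q \<in> lucky_sieve i \<and> sieving_number i < q)"
  by (simp add: lucky_sieve_def sieving_number_def Let_def split: prod.split)

lemma lucky_sieve_antimono: "i \<le> j \<Longrightarrow> lucky_sieve j \<subseteq> lucky_sieve i"
  by (induction rule: dec_induct) (auto simp: lucky_sieve_Suc remove_every_def)

lemma zero_notin_lucky_sieve: "0 \<notin> lucky_sieve i"
  using lucky_sieve_antimono[of 0 i] by (auto simp: lucky_sieve_0)

text \<open>The two claims feed each other: an infinite set contains a next sieving number, which
  exceeds one that is at least 1 and so is at least 2, and with such a step the removal leaves the
  set infinite.\<close>

lemma infinite_lucky_sieve_sieving_number_pos: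
  "infinite (lucky_sieve i) \<and> sieving_number i \<ge> 1"
proof (induction i)
  case 0
  then show ?case by (simp add: lucky_sieve_0 sieving_number_0 infinite_Ici)
next
  case (Suc i)
  then obtain q where "q \<in> lucky_sieve i \<and> sieving_number i < q"
    by (meson infinite_nat_iff_unbounded)
  then have "sieving_number i < sieving_number (Suc i)"
    unfolding sieving_number_Suc by (rule LeastI2) simp
  then show ?case
    using Suc by (simp add: lucky_sieve_Suc infinite_remove_every zero_notin_lucky_sieve)
qed

lemmas infinite_lucky_sieve = infinite_lucky_sieve_sieving_number_pos[THEN conjunct1]

lemma sieving_number_Suc_in: "sieving_number (Suc i) \<in> lucky_sieve i"
  and sieving_number_less_Suc: "sieving_number i < sieving_number (Suc i)"
proof -
  obtain q where "q \<in> lucky_sieve i \<and> sieving_number i < q"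
    using infinite_lucky_sieve[of i] by (meson infinite_nat_iff_unbounded)
  then have "sieving_number (Suc i) \<in> lucky_sieve i \<and> sieving_number i < sieving_number (Suc i)"
    unfolding sieving_number_Suc by (rule LeastI)
  then show "sieving_number (Suc i) \<in> lucky_sieve i" "sieving_number i < sieving_number (Suc i)"
    by auto
qed

lemma strict_mono_sieving_number: "strict_mono sieving_number"
  by (simp add: strict_mono_Suc_iff sieving_number_less_Suc)

lemma sieving_number_ge_2: "i \<ge> 1 \<Longrightarrow> sieving_number i \<ge> 2"
  using strict_monoD[OF strict_mono_sieving_number, of 0 i] by (simp add: sieving_number_0)

lemma sieving_number_1: "sieving_number 1 = 2"
proof -
  have "(LEAST q. q \<in> {1..} \<and> 1 < q) = (2::nat)"
    by (rule Least_equality) auto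
  then show ?thesis by (simp add: sieving_number_Suc lucky_sieve_0 sieving_number_0)
qed

section \<open>Ranks along the sieve and stable initial segments\<close>

lemma rank_lucky_sieve_0: "rank (lucky_sieve 0) x = x"
proof -
  have "{y \<in> {1..}. y \<le> x} = {1..x}" by auto
  then show ?thesis by (simp add: lucky_sieve_0)
qed

lemma rank_lucky_sieve_Suc:
  "rank (lucky_sieve (Suc i)) x =
    rank (lucky_sieve i) x - rank (lucky_sieve i) x div sieving_number (Suc i)"
  by (simp add: lucky_sieve_Suc rank_remove_every zero_notin_lucky_sieve)

lemma rank_lucky_sieve_less:
  assumes "i \<ge> 1" "x \<ge> 2"
  shows "rank (lucky_sieve i) x < x"
proof -
  have "rank (lucky_sieve i) x \<le> rank (lucky_sieve 1) x"
    using lucky_sieve_antimono[OF assms(1)] by (intro card_mono) auto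
  also have "\<dots> = x - x div 2"
    using rank_lucky_sieve_Suc[of 0 x] sieving_number_1 by (simp add: rank_lucky_sieve_0)
  also have "\<dots> < x" using assms by simp
  finally show ?thesis .
qed

text \<open>A positive rank below the sieving number cannot be a multiple of it.\<close>

lemma lucky_sieve_Suc_initial_segment:
  assumes "rank (lucky_sieve i) x < sieving_number (Suc i)"
  shows "{y \<in> lucky_sieve (Suc i). y \<le> x} = {y \<in> lucky_sieve i. y \<le> x}"
proof -
  have "\<not> sieving_number (Suc i) dvd rank (lucky_sieve i) y"
    if "y \<in> lucky_sieve i" "y \<le> x" for y
  proof -
    have "rank (lucky_sieve i) y < sieving_number (Suc i)"
      using rank_mono[OF that(2)] assms by (rule le_less_trans)
    moreover have "rank (lucky_sieve i) y > 0"
      using that by (auto simp: card_gt_0_iff)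
    ultimately show ?thesis by (simp add: nat_dvd_not_less)
  qed
  then show ?thesis by (auto simp: lucky_sieve_Suc remove_every_def)
qed

text \<open>The condition propagates: a step that leaves the segment up to \<open>x\<close> intact
  keeps the rank of \<open>x\<close>, while the sieving numbers only grow.\<close>

lemma lucky_numbers_initial_segment:
  assumes "rank (lucky_sieve i) x < sieving_number (Suc i)"
  shows "{y \<in> lucky_numbers. y \<le> x} = {y \<in> lucky_sieve i. y \<le> x}"
proof -
  have later: "{y \<in> lucky_sieve j. y \<le> x} = {y \<in> lucky_sieve i. y \<le> x}" if "i \<le> j" for j
    using that
  proof (induction rule: dec_induct)
    case (step j)
    have "sieving_number (Suc i) \<le> sieving_number (Suc j)"
      using step strict_mono_less_eq[OF strict_mono_sieving_number] by simp
    then have "rank (lucky_sieve j) x < sieving_number (Suc j)"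
      using step assms by simp
    then show ?case using step lucky_sieve_Suc_initial_segment by simp
  qed simp
  show ?thesis
  proof (intro equalityI subsetI)
    fix y assume y: "y \<in> {y \<in> lucky_sieve i. y \<le> x}"
    have "y \<in> lucky_sieve j" for j
    proof (cases "i \<le> j")
      case True
      then show ?thesis using later y by blast
    next
      case False
      then show ?thesis using lucky_sieve_antimono[of j i] y by auto
    qed
    then show "y \<in> {y \<in> lucky_numbers. y \<le> x}" using y by (simp add: lucky_numbers_def)
  qed (auto simp: lucky_numbers_def)
qed

text \<open>Each new sieving number is the immediate successor of the previous one among the
  survivors, so its rank goes up by one. The count starts at \<open>i = 1\<close>, since 2 has rank
  2 in \<open>lucky_sieve 0\<close> and is removed by its own step.\<close>

lemma rank_sieving_number_Suc:
  assumes "i \<ge> 1"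
  shows "rank (lucky_sieve i) (sieving_number (Suc i)) = i + 1"
  using assms
proof (induction i rule: dec_induct)
  let ?next = "\<lambda>i. insert (sieving_number (Suc i)) {y \<in> lucky_sieve i. y \<le> sieving_number i}"
  \<comment> \<open>By the minimality in \<open>LEAST\<close>, no element of
    \<open>lucky_sieve i\<close> lies strictly between consecutive sieving numbers.\<close>
  have next_segment: "{y \<in> lucky_sieve i. y \<le> sieving_number (Suc i)} = ?next i" for i
    using sieving_number_Suc_in[of i] sieving_number_less_Suc[of i]
      not_less_Least[of _ "\<lambda>q. q \<in> lucky_sieve i \<and> sieving_number i < q", folded sieving_number_Suc]
    by (force simp: not_less)
  have rank_next: "rank (lucky_sieve i) (sieving_number (Suc i)) =
      Suc (rank (lucky_sieve i) (sieving_number i))" for i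
    unfolding next_segment using sieving_number_less_Suc[of i] by simp
  {
    case base
    have "rank (lucky_sieve 1) 2 = 1"
      using rank_lucky_sieve_Suc[of 0 2] sieving_number_1 by (simp add: rank_lucky_sieve_0)
    then show ?case using rank_next[of 1] sieving_number_1 by simp
  next
    case (step i)
    \<comment> \<open>A sieving number exceeds its own rank, hence it survives its own step with its
      rank unchanged.\<close>
    have "rank (lucky_sieve i) (sieving_number (Suc i)) < sieving_number (Suc i)"
      using step by (intro rank_lucky_sieve_less sieving_number_ge_2) auto
    then have "rank (lucky_sieve (Suc i)) (sieving_number (Suc i)) = i + 1"
      using lucky_sieve_Suc_initial_segment step by simp
    then show ?case using rank_next[of "Suc i"] by simp
  }
qed

section \<open>Lucky numbers as sieving numbers\<close>

lemma sieving_number_lucky: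
  assumes "i \<ge> 2"
  shows "sieving_number i \<in> lucky_numbers" "rank lucky_numbers (sieving_number i) = i"
proof -
  obtain j where j: "i = Suc j" "j \<ge> 1" using assms by (cases i) auto
  \<comment> \<open>This makes the segment up to \<open>sieving_number i\<close> final already in
    \<open>lucky_sieve j\<close>, so membership and rank carry over to
    \<open>lucky_numbers\<close>.\<close>
  have "rank (lucky_sieve j) (sieving_number i) < sieving_number i"
    using j by (intro rank_lucky_sieve_less sieving_number_ge_2) auto
  then have seg: "{y \<in> lucky_numbers. y \<le> sieving_number i} = {y \<in> lucky_sieve j. y \<le> sieving_number i}"
    using j by (intro lucky_numbers_initial_segment) auto
  then show "sieving_number i \<in> lucky_numbers"
    using sieving_number_Suc_in[of j] j by blast
  show "rank lucky_numbers (sieving_number i) = i"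
    unfolding seg using rank_sieving_number_Suc j by simp
qed

lemma infinite_lucky_numbers: "infinite lucky_numbers"
proof -
  have "infinite (sieving_number ` {2..})"
    using strict_mono_imp_inj_on[OF strict_mono_sieving_number]
    by (meson finite_imageD infinite_Ici inj_on_subset subset_UNIV)
  then show ?thesis
    using sieving_number_lucky(1) by (meson atLeast_iff finite_subset image_subsetI)
qed

lemma lucky_rank:
  assumes "x \<in> lucky_numbers" "rank lucky_numbers x = n" "n \<ge> 2"
  shows "lucky n = x"
  using enumerate_rank[OF infinite_lucky_numbers assms(1)] assms by (simp add: lucky_def)

text \<open>The convention for \<open>lucky 1\<close> matches the first sieving number; from index 2
  on, both sides are the lucky number of rank \<open>i\<close>.\<close>

lemma lucky_eq_sieving_number: "i \<ge> 1 \<Longrightarrow> lucky i = sieving_number i"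
  using sieving_number_1 sieving_number_lucky lucky_rank
  by (cases "i = 1") (auto simp: lucky_def)

lemma lucky_count_of_nat: "lucky_count (real n) = rank lucky_numbers n"
  by (simp add: lucky_count_def)

lemma lucky_count_pos:
  assumes "n \<ge> 1"
  shows "lucky_count (real n) \<ge> 1"
proof -
  have "{y \<in> lucky_numbers. y \<le> 1} = {y \<in> lucky_sieve 0. y \<le> 1}"
    using sieving_number_1 rank_lucky_sieve_0[of 1] by (intro lucky_numbers_initial_segment) simp
  then have "rank lucky_numbers 1 = 1"
    using rank_lucky_sieve_0[of 1] by simp
  then show ?thesis
    unfolding lucky_count_of_nat using rank_mono[OF assms, of lucky_numbers] by simp
qed

lemma less_sieving_number_Suc_lucky_count:
  assumes "n \<ge> 1"
  shows "n < sieving_number (Suc (lucky_count (real n)))"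
proof (rule ccontr)
  let ?b = "lucky_count (real n)"
  assume "\<not> ?thesis"
  then have "rank lucky_numbers (sieving_number (Suc ?b)) \<le> ?b"
    unfolding lucky_count_of_nat by (intro rank_mono) simp
  \<comment> \<open>Since \<open>?b\<close> is positive, the index \<open>Suc ?b\<close> is at least
    2, so its sieving number is lucky of rank \<open>Suc ?b\<close>.\<close>
  then show False
    using sieving_number_lucky(2)[of "Suc ?b"] lucky_count_pos[OF assms] by simp
qed

lemma lucky_in_sieve_rank:
  assumes "n \<ge> 2"
  shows "lucky n \<in> lucky_numbers"
    and "rank (lucky_sieve (lucky_count (real n))) (lucky n) = n"
proof -
  let ?A = "lucky_sieve (lucky_count (real n))"
  \<comment> \<open>The candidate for \<open>lucky n\<close> is the element of rank \<open>n\<close>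
    in \<open>?A\<close>. As \<open>n\<close> is below the next sieving number, everything up to it
    is final.\<close>
  define m where "m = enumerate ?A (n - 1)"
  have m: "m \<in> ?A" "rank ?A m = n"
    using assms infinite_lucky_sieve by (auto simp: m_def enumerate_in_set rank_enumerate)
  then have seg: "{y \<in> lucky_numbers. y \<le> m} = {y \<in> ?A. y \<le> m}"
    using assms less_sieving_number_Suc_lucky_count[of n]
    by (intro lucky_numbers_initial_segment) simp
  then have "m \<in> lucky_numbers" "rank lucky_numbers m = n"
    using m by auto
  moreover from this have "lucky n = m" using lucky_rank assms by blast
  ultimately show "lucky n \<in> lucky_numbers" "rank ?A (lucky n) = n"
    using m by auto
qed

section \<open>Inverting one removal step, and the two formulas\<close>

lemma
  fixes r l :: nat
  assumes "l \<ge> 2" "\<not> l dvd r"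
  shows ceiling_inverts_removal: "\<lceil>real (r - r div l) * (real l / (real l - 1)) - 1\<rceil> = int r"
    and floor_inverts_removal: "\<lfloor>(real (r - r div l) * real l - 1) / (real l - 1)\<rfloor> = int r"
proof -
  \<comment> \<open>With \<open>r = q * l + s\<close> and \<open>1 \<le> s \<le> l - 1\<close>, the
    new rank is \<open>q * (l - 1) + s\<close>. The first expression becomes
    \<open>r + s / (l - 1) - 1\<close>, in \<open>(r - 1, r]\<close>, and the second
    \<open>r + (s - 1) / (l - 1)\<close>, in \<open>[r, r + 1)\<close>.\<close>
  define q s where "q = r div l" and "s = r mod l"
  have s: "1 \<le> s" "s + 1 \<le> l"
    using assms by (auto simp: s_def dvd_eq_mod_eq_0 Suc_le_eq)
  have r: "r = q * l + s" by (simp add: q_def s_def)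
  have "r - r div l = q * l + s - q" using r by (simp add: q_def)
  moreover have "q \<le> q * l + s" using assms by (simp add: trans_le_add1)
  ultimately have r': "real (r - r div l) = real q * (real l - 1) + real s"
    by (simp only: of_nat_diff of_nat_add of_nat_mult) (simp add: algebra_simps)
  have l: "real l - 1 > 0" using assms by simp
  have "real (r - r div l) * (real l / (real l - 1)) - 1 = real r + (real s / (real l - 1) - 1)"
    unfolding r' using l by (simp add: r field_simps)
  moreover have "0 < real s / (real l - 1)" "real s / (real l - 1) \<le> 1"
    using s l by (auto simp: field_simps)
  ultimately show "\<lceil>real (r - r div l) * (real l / (real l - 1)) - 1\<rceil> = int r"
    by (intro ceiling_unique) simp_all
  have "(real (r - r div l) * real l - 1) / (real l - 1) = real r + (real s - 1) / (real l - 1)"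
    unfolding r' using l by (simp add: r field_simps)
  moreover have "0 \<le> (real s - 1) / (real l - 1)" "(real s - 1) / (real l - 1) < 1"
    using s l by (auto simp: field_simps)
  ultimately show "\<lfloor>(real (r - r div l) * real l - 1) / (real l - 1)\<rfloor> = int r"
    by (intro floor_unique) simp_all
qed

theorem proposition2p3:
  fixes n \<beta> :: nat and a b :: "nat \<Rightarrow> int"
  assumes "n \<ge> 2"
    and "\<beta> = lucky_count (real n)"
    and "a 0 = int n"
    and "\<And>i. i < \<beta> \<Longrightarrow> a (Suc i) =
          \<lceil>real_of_int (a i) * (real (lucky (\<beta> - i)) / (real (lucky (\<beta> - i)) - 1)) - 1\<rceil>"
    and "b 0 = int n"
    and "\<And>i. i < \<beta> \<Longrightarrow> b (Suc i) =
          \<lfloor>(real_of_int (b i) * real (lucky (\<beta> - i)) - 1) / (real (lucky (\<beta> - i)) - 1)\<rfloor>"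
  shows "int (lucky n) = a \<beta> \<and> int (lucky n) = b \<beta>"
proof -
  \<comment> \<open>Both sequences run through \<open>c \<beta>, ..., c 0\<close>: they start at
    \<open>c \<beta> = n\<close> and end at \<open>c 0 = lucky n\<close>.\<close>
  define c where "c i = rank (lucky_sieve i) (lucky n)" for i
  have "a i = int (c (\<beta> - i)) \<and> b i = int (c (\<beta> - i))" if "i \<le> \<beta>" for i
    using that
  proof (induction i)
    case 0
    then show ?case using assms lucky_in_sieve_rank(2) by (simp add: c_def)
  next
    case (Suc i)
    define j where "j = \<beta> - Suc i"
    have j: "\<beta> - i = Suc j" using Suc.prems by (simp add: j_def)
    have l: "lucky (\<beta> - i) = sieving_number (Suc j)" "sieving_number (Suc j) \<ge> 2"
      by (simp_all add: j lucky_eq_sieving_number sieving_number_ge_2)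
    \<comment> \<open>A lucky number survives every step, so its rank \<open>c j\<close> is not a
      multiple of the sieving number, as the inversion requires.\<close>
    have "lucky n \<in> lucky_sieve (Suc j)"
      using lucky_in_sieve_rank(1)[OF assms(1)] unfolding lucky_numbers_def by blast
    then have ndvd: "\<not> sieving_number (Suc j) dvd c j"
      by (simp add: lucky_sieve_Suc remove_every_def c_def)
    have ab: "real_of_int (a i) = real (c j - c j div sieving_number (Suc j))"
        "real_of_int (b i) = real (c j - c j div sieving_number (Suc j))"
      using Suc by (simp_all add: j c_def rank_lucky_sieve_Suc)
    have i: "i < \<beta>" using Suc.prems by simp
    have "a (Suc i) = int (c j)"
      unfolding assms(4)[OF i] l ab by (rule ceiling_inverts_removal[OF l(2) ndvd])
    moreover have "b (Suc i) = int (c j)"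
      unfolding assms(6)[OF i] l ab by (rule floor_inverts_removal[OF l(2) ndvd])
    ultimately show ?case by (simp add: j_def)
  qed
  from this[of \<beta>] show ?thesis
    by (simp add: c_def rank_lucky_sieve_0)
qed

end
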